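(* Suppose $s \in [0,1]$. Then there exist real sequences $\{a_n(s)\}_n$ and $\{b_n(s)\}_n$, with $b_n(s)>0$ for all but finitely many $n$, such that \[ \lim_{n \to \infty} \sup_{x \in \mathbb{R}} \left| \frac{1}{P_n^{h_s}(1)} \sum_{k \le a_n(s) + x\, b_n(s)} A_{n,k}(s) - \frac{1}{\sqrt{2\pi}} \int_{-\infty}^{x} e^{-t^2/2}\, dt \right| = 0 . \]
   Context: For $s\in\mathbb{R}$ define polynomials $P_n^{h_s}(x)$ recursively by $P_0^{h_s}(x):=1$ and, for $n\ge 1$, $P_n^{h_s}(x) := \frac{x}{n^s}\sum_{k=0}^{n-1} P_k^{h_s}(x)$. Write $P_n^{h_s}(x)=\sum_{k=0}^n A_{n,k}(s)\,x^k$; the numbers $A_{n,k}(s)$ are its coefficients (so $A_{n,k}(0)=\binom{n-1}{k-1}$ and $A_{n,k}(1)=\frac{1}{n!}\left[{n \atop k}\right]$, unsigned Stirling numbers of the first kind). *)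

theory Defs
  imports "HOL-Analysis.Analysis" "HOL-Computational_Algebra.Polynomial"
begin

fun Ph :: "real \<Rightarrow> nat \<Rightarrow> real poly" where
  "Ph s 0 = 1"
| "Ph s (Suc n) = smult (1 / real (Suc n) powr s) ([:0, 1:] * (\<Sum>k\<in>{0..n}. Ph s k))"

definition Acoef :: "nat \<Rightarrow> nat \<Rightarrow> real \<Rightarrow> real" where
  "Acoef n k s = coeff (Ph s n) k"

end

theory Submission
  imports Defs "HOL-Probability.Probability"
begin

text \<open>
  The recursion telescopes to \<open>(n + 1)\<^sup>s P\<^bsub>n+1\<^esub>(x) = (n\<^sup>s + x) P\<^sub>n(x)\<close>, so that
  \<open>P\<^sub>n(x) / P\<^sub>n(1)\<close> equals \<open>\<Prod>k<n. (1 - p\<^sub>k + p\<^sub>k x)\<close> with \<open>p\<^sub>0 = 1\<close> and \<open>p\<^sub>k = 1 / (1 + k\<^sup>s)\<close>. It is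
  the probability generating function of a sum of independent Bernoulli variables. For
  \<open>0 \<le> s \<le> 1\<close> the variance of this sum is at least a quarter of a harmonic number, hence
  unbounded. The central limit theorem for bounded independent variables, which follows from
  Levy's continuity theorem by comparing the factors of the characteristic functions with Gaussian
  ones, gives convergence in distribution. As the limiting distribution function is continuous,
  the convergence is uniform (Polya).
\<close>

section \<open>Uniform convergence of distribution functions\<close>

lemma uniform_limit_imp_SUP_dist_tendsto_0:
  fixes f :: "'i \<Rightarrow> 'a \<Rightarrow> 'b::metric_space"
  assumes lim: "uniform_limit S f g F" and "S \<noteq> {}"
  shows "((\<lambda>n. SUP x\<in>S. dist (f n x) (g x)) \<longlongrightarrow> 0) F"
proof (rule tendstoI)
  fix e :: real assume "0 < e"
  then have "\<forall>\<^sub>F n in F. \<forall>x\<in>S. dist (f n x) (g x) < e / 2"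
    using uniform_limitD[OF lim, of "e / 2"] by simp
  then show "\<forall>\<^sub>F n in F. dist (SUP x\<in>S. dist (f n x) (g x)) 0 < e"
  proof eventually_elim
    case (elim n)
    obtain z where "z \<in> S" using \<open>S \<noteq> {}\<close> by blast
    have "(SUP x\<in>S. dist (f n x) (g x)) \<le> e / 2"
      using elim \<open>S \<noteq> {}\<close> by (intro cSUP_least) (auto intro: less_imp_le)
    moreover have "0 \<le> (SUP x\<in>S. dist (f n x) (g x))"
      using elim \<open>z \<in> S\<close> by (intro cSUP_upper2[of _ _ z] bdd_aboveI2[where M = "e / 2"])
        (auto intro: less_imp_le)
    ultimately show ?case using \<open>0 < e\<close> by simp
  qed
qed

lemma (in real_distribution) ex_cdf_eq:
  assumes cont: "continuous_on UNIV (cdf M)" and y: "0 < y" "y < 1"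
  shows "\<exists>x. cdf M x = y"
proof -
  obtain a where a: "cdf M a < y"
    using order_tendstoD(2)[OF cdf_lim_at_bot y(1)] eventually_happens by fastforce
  obtain b where b: "y < cdf M b"
    using order_tendstoD(1)[OF cdf_lim_at_top_prob y(2)] eventually_happens by fastforce
  have "a \<le> b"
    using a b cdf_nondecreasing[of b a] by linarith
  then show ?thesis
    using IVT'[of "cdf M" a y b] a b continuous_on_subset[OF cont subset_UNIV] by auto
qed

lemma ex_grid_point_less:
  fixes x :: real
  assumes "1 / real N < x" "x \<le> 1" "0 < N"
  obtains i where "i \<in> {1..<N}" "real i / real N < x" "x \<le> real i / real N + 1 / real N"
proof -
  define i where "i = nat (\<lceil>real N * x\<rceil> - 1)"
  have "1 < real N * x" "real N * x \<le> real N"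
    using assms by (auto simp: field_simps)
  then have i: "real i < real N * x" "real N * x \<le> real i + 1" "1 \<le> i" "real i < real N"
    unfolding i_def by linarith+
  then show thesis
    using assms(3) by (intro that[of i]) (auto simp: field_simps)
qed

lemma (in finite_borel_measure) cdf_less_imp_less: "cdf M x < cdf M y \<Longrightarrow> x < y"
  using cdf_nondecreasing[of y x] by (meson not_le)

lemma (in real_distribution) ex_finite_cdf_grid:
  assumes cont: "continuous_on UNIV (cdf M)" and "0 < e"
  obtains X where "finite X"
    and "\<And>y. e < cdf M y \<Longrightarrow> \<exists>x\<in>X. x < y \<and> cdf M y \<le> cdf M x + e"
    and "\<And>y. cdf M y < 1 - e \<Longrightarrow> \<exists>x\<in>X. y < x \<and> cdf M x \<le> cdf M y + e"
proof -
  obtain N :: nat where N: "0 < N" "1 / real N < e"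
    using ex_inverse_of_nat_less[OF \<open>0 < e\<close>] by (auto simp: inverse_eq_divide)
  have "\<exists>q. \<forall>i\<in>{1..<N}. cdf M (q i) = real i / real N"
    by (intro bchoice ballI ex_cdf_eq cont) auto
  then obtain q where q: "\<forall>i\<in>{1..<N}. cdf M (q i) = real i / real N" by blast
  show thesis
  proof (rule that[of "q ` {1..<N}"])
    fix y assume "e < cdf M y"
    then have "1 / real N < cdf M y" using N(2) by linarith
    then obtain i where i: "i \<in> {1..<N}" "real i / real N < cdf M y"
        "cdf M y \<le> real i / real N + 1 / real N"
      using ex_grid_point_less cdf_bounded_prob N(1) by metis
    then have "q i < y" "cdf M y \<le> cdf M (q i) + e"
      using q N(2) by (auto intro: cdf_less_imp_less)
    with i(1) show "\<exists>x\<in>q ` {1..<N}. x < y \<and> cdf M y \<le> cdf M x + e" by blast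
  next
    fix y assume "cdf M y < 1 - e"
    then have "1 / real N < 1 - cdf M y" "1 - cdf M y \<le> 1"
      using N(2) cdf_nonneg[of y] by linarith+
    then obtain j where j: "j \<in> {1..<N}" "real j / real N < 1 - cdf M y"
        "1 - cdf M y \<le> real j / real N + 1 / real N"
      using ex_grid_point_less N(1) by metis
    then have i: "N - j \<in> {1..<N}" and "real (N - j) / real N = 1 - real j / real N"
      using N(1) by (auto simp: diff_divide_distrib)
    then have "cdf M (q (N - j)) = 1 - real j / real N"
      using q by metis
    then have "y < q (N - j)" "cdf M (q (N - j)) \<le> cdf M y + e"
      using j N(2) by (auto intro: cdf_less_imp_less)
    with i show "\<exists>x\<in>q ` {1..<N}. y < x \<and> cdf M x \<le> cdf M y + e" by blast
  qed simp
qed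

theorem Polya_uniform_limit_cdf:
  assumes distr: "\<And>n. real_distribution (M n)" "real_distribution M'"
    and cont: "continuous_on UNIV (cdf M')"
    and lim: "\<And>x. ((\<lambda>n. cdf (M n) x) \<longlongrightarrow> cdf M' x) F"
  shows "uniform_limit UNIV (\<lambda>n. cdf (M n)) (cdf M') F"
proof (rule uniform_limitI)
  interpret M': real_distribution M' by fact
  interpret Mn: real_distribution "M n" for n by (rule distr)
  fix e :: real assume "0 < e"
  then have "0 < e / 3" by simp
  then obtain X where X: "finite X"
      "\<And>y. e / 3 < cdf M' y \<Longrightarrow> \<exists>x\<in>X. x < y \<and> cdf M' y \<le> cdf M' x + e / 3"
      "\<And>y. cdf M' y < 1 - e / 3 \<Longrightarrow> \<exists>x\<in>X. y < x \<and> cdf M' x \<le> cdf M' y + e / 3"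
    using M'.ex_finite_cdf_grid[OF cont] by blast
  have "\<forall>\<^sub>F n in F. \<forall>x\<in>X. dist (cdf (M n) x) (cdf M' x) < e / 3"
    using X(1) tendstoD[OF lim \<open>0 < e / 3\<close>] by (simp add: eventually_ball_finite)
  then show "\<forall>\<^sub>F n in F. \<forall>y\<in>UNIV. dist (cdf (M n) y) (cdf M' y) < e"
  proof eventually_elim
    case (elim n)
    have on_grid: "\<bar>cdf (M n) x - cdf M' x\<bar> < e / 3" if "x \<in> X" for x
      using elim that by (simp add: dist_real_def)
    have "cdf M' y - e < cdf (M n) y" for y
    proof (cases "e / 3 < cdf M' y")
      case True
      then obtain x where "x \<in> X" "x < y" "cdf M' y \<le> cdf M' x + e / 3" using X(2) by blast
      then show ?thesis
        using on_grid[of x] Mn.cdf_nondecreasing[of x y n] \<open>0 < e\<close> by linarith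
    next
      case False
      then show ?thesis using Mn.cdf_nonneg[of n y] \<open>0 < e\<close> by linarith
    qed
    moreover have "cdf (M n) y < cdf M' y + e" for y
    proof (cases "cdf M' y < 1 - e / 3")
      case True
      then obtain x where "x \<in> X" "y < x" "cdf M' x \<le> cdf M' y + e / 3" using X(3) by blast
      then show ?thesis
        using on_grid[of x] Mn.cdf_nondecreasing[of y x n] \<open>0 < e\<close> by linarith
    next
      case False
      then show ?thesis using Mn.cdf_bounded_prob[of n y] \<open>0 < e\<close> by linarith
    qed
    ultimately show ?case
      by (simp add: dist_real_def abs_less_iff less_diff_eq diff_less_eq add.commute)
  qed
qed

lemma weak_conv_m_imp_uniform_limit_cdf:
  assumes "\<And>n. real_distribution (M n)" "real_distribution M'"
    and "continuous_on UNIV (cdf M')" and "weak_conv_m M M'"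
  shows "uniform_limit UNIV (\<lambda>n. cdf (M n)) (cdf M') sequentially"
  using assms by (intro Polya_uniform_limit_cdf)
    (auto simp: weak_conv_m_def weak_conv_def continuous_on_eq_continuous_at)

lemma continuous_on_cdf_density:
  assumes "finite_borel_measure (density lborel f)" and [measurable]: "f \<in> borel_measurable borel"
  shows "continuous_on UNIV (cdf (density lborel f))"
proof -
  interpret finite_borel_measure "density lborel f" by fact
  have "emeasure (density lborel f) {x} = 0" for x
    by (subst emeasure_density) (auto)
  then show ?thesis
    by (auto simp: continuous_on_eq_continuous_at isCont_cdf measure_def)
qed

lemma cdf_std_normal_distribution:
  "cdf std_normal_distribution x = 1 / sqrt (2 * pi) * (LBINT t:{..x}. exp (- t\<^sup>2 / 2))"
proof -
  have "cdf std_normal_distribution x = (LINT t|std_normal_distribution. indicator {..x} t)"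
    by (simp add: cdf_def)
  also have "\<dots> = (LBINT t. std_normal_density t *\<^sub>R indicator {..x} t)"
    by (intro integral_density) auto
  also have "\<dots> = (LBINT t. 1 / sqrt (2 * pi) * (indicator {..x} t *\<^sub>R exp (- t\<^sup>2 / 2)))"
    by (intro Bochner_Integration.integral_cong) (auto simp: std_normal_density_def)
  also have "\<dots> = 1 / sqrt (2 * pi) * (LBINT t:{..x}. exp (- t\<^sup>2 / 2))"
    unfolding set_lebesgue_integral_def by (rule integral_mult_right_zero)
  finally show ?thesis .
qed

section \<open>The central limit theorem for bounded independent variables\<close>

lemma abs_exp_minus_approx:
  fixes y :: real
  assumes "0 \<le> y"
  shows "\<bar>exp (- y) - (1 - y)\<bar> \<le> y\<^sup>2"
proof -
  have "exp (- y) \<le> 1 / (1 + y)"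
    using assms exp_ge_add_one_self[of y] by (simp add: exp_minus inverse_eq_divide frac_le)
  also have "\<dots> \<le> 1 - y + y\<^sup>2"
    using assms by (simp add: field_simps power2_eq_square)
  finally show ?thesis
    using exp_ge_add_one_self[of "- y"] by simp
qed

lemma (in prob_space) expectation_square_le_bound:
  fixes X :: "'a \<Rightarrow> real"
  assumes [measurable]: "random_variable borel X" and bound: "AE \<omega> in M. \<bar>X \<omega>\<bar> \<le> B"
  shows "integrable M (\<lambda>\<omega>. (X \<omega>)\<^sup>2)" and "expectation (\<lambda>\<omega>. (X \<omega>)\<^sup>2) \<le> B\<^sup>2"
proof -
  have "AE \<omega> in M. (X \<omega>)\<^sup>2 \<le> B\<^sup>2"
    using bound by eventually_elim (auto simp: abs_le_square_iff[symmetric])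
  then show integrable: "integrable M (\<lambda>\<omega>. (X \<omega>)\<^sup>2)"
    by (intro integrable_const_bound[where B = "B\<^sup>2"]) auto
  show "expectation (\<lambda>\<omega>. (X \<omega>)\<^sup>2) \<le> B\<^sup>2"
    using integral_mono_AE[OF integrable integrable_const \<open>AE \<omega> in M. (X \<omega>)\<^sup>2 \<le> B\<^sup>2\<close>]
    by (simp add: prob_space)
qed

lemma (in prob_space) char_bounded_approx_quadratic:
  fixes X :: "'a \<Rightarrow> real"
  assumes X [measurable]: "random_variable borel X"
    and mean: "expectation X = 0" and bound: "AE \<omega> in M. \<bar>X \<omega>\<bar> \<le> B"
  shows "norm (char (distr M borel X) t - of_real (1 - t\<^sup>2 * variance X / 2))
    \<le> variance X * (t\<^sup>2 * (B * \<bar>t\<bar>))"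
proof -
  have X_integrable: "integrable M X"
    using bound by (intro integrable_const_bound[where B = B]) auto
  note square_integrable = expectation_square_le_bound(1)[OF X bound]
  have "AE \<omega> in M. 0 \<le> B"
    using bound by eventually_elim linarith
  then have "0 \<le> B" by simp
  have "norm (char (distr M borel X) t - (1 - t\<^sup>2 * variance X / 2))
      \<le> t\<^sup>2 / 6 * expectation (\<lambda>\<omega>. min (6 * (X \<omega>)\<^sup>2) (\<bar>t\<bar> * \<bar>X \<omega>\<bar> ^ 3))"
    by (rule char_approx3'[OF X X_integrable square_integrable mean refl refl])
  also have "\<dots> \<le> t\<^sup>2 / 6 * expectation (\<lambda>\<omega>. (B * \<bar>t\<bar>) * (X \<omega>)\<^sup>2)"
  proof (intro mult_left_mono integral_mono_AE)
    show "AE \<omega> in M. min (6 * (X \<omega>)\<^sup>2) (\<bar>t\<bar> * \<bar>X \<omega>\<bar> ^ 3) \<le> (B * \<bar>t\<bar>) * (X \<omega>)\<^sup>2"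
      using bound
    proof eventually_elim
      case (elim \<omega>)
      then have "\<bar>X \<omega>\<bar> * (\<bar>t\<bar> * (X \<omega>)\<^sup>2) \<le> B * (\<bar>t\<bar> * (X \<omega>)\<^sup>2)"
        by (intro mult_right_mono) auto
      then show ?case
        by (simp add: power3_eq_cube power2_eq_square mult_ac min.coboundedI2)
    qed
    show "integrable M (\<lambda>\<omega>. min (6 * (X \<omega>)\<^sup>2) (\<bar>t\<bar> * \<bar>X \<omega>\<bar> ^ 3))"
      by (rule Bochner_Integration.integrable_bound[where f = "\<lambda>\<omega>. 6 * (X \<omega>)\<^sup>2"])
         (use square_integrable in auto)
  qed (use square_integrable in auto)
  also have "\<dots> = variance X * (t\<^sup>2 * (B * \<bar>t\<bar>)) / 6"
    using mean by simp
  also have "\<dots> \<le> variance X * (t\<^sup>2 * (B * \<bar>t\<bar>))"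
    using \<open>0 \<le> B\<close> by simp
  finally show ?thesis by simp
qed

lemma (in prob_space) char_bounded_approx_gaussian:
  fixes X :: "'a \<Rightarrow> real"
  assumes X: "random_variable borel X"
    and mean: "expectation X = 0" and bound: "AE \<omega> in M. \<bar>X \<omega>\<bar> \<le> B"
  shows "norm (char (distr M borel X) t - of_real (exp (- (t\<^sup>2 * variance X / 2))))
    \<le> variance X * (t\<^sup>2 * (B * \<bar>t\<bar> + (B * t)\<^sup>2))"
proof -
  define \<sigma>2 where "\<sigma>2 = variance X"
  have \<sigma>2: "0 \<le> \<sigma>2" "\<sigma>2 \<le> B\<^sup>2"
    using expectation_square_le_bound(2)[OF X bound] mean by (simp_all add: \<sigma>2_def)
  have "norm (of_real (1 - t\<^sup>2 * \<sigma>2 / 2) - of_real (exp (- (t\<^sup>2 * \<sigma>2 / 2))) :: complex)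
      = \<bar>exp (- (t\<^sup>2 * \<sigma>2 / 2)) - (1 - t\<^sup>2 * \<sigma>2 / 2)\<bar>"
    unfolding of_real_diff[symmetric] norm_of_real by (rule abs_minus_commute)
  also have "\<dots> \<le> (t\<^sup>2 * \<sigma>2 / 2)\<^sup>2"
    using \<sigma>2 by (intro abs_exp_minus_approx) auto
  also have "\<dots> = \<sigma>2 * (t\<^sup>2 * (\<sigma>2 / 4 * t\<^sup>2))"
    by (simp add: power2_eq_square)
  also have "\<dots> \<le> \<sigma>2 * (t\<^sup>2 * (B * t)\<^sup>2)"
    unfolding power_mult_distrib using \<sigma>2 by (intro mult_left_mono mult_right_mono) auto
  finally have "norm (char (distr M borel X) t - of_real (exp (- (t\<^sup>2 * \<sigma>2 / 2))))
      \<le> \<sigma>2 * (t\<^sup>2 * (B * \<bar>t\<bar>)) + \<sigma>2 * (t\<^sup>2 * (B * t)\<^sup>2)"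
    using norm_diff_triangle_le char_bounded_approx_quadratic[OF X mean bound] unfolding \<sigma>2_def
    by blast
  then show ?thesis
    unfolding \<sigma>2_def by (simp only: distrib_left)
qed

lemma (in prob_space) char_sum_bounded_approx_gaussian:
  fixes X :: "'i \<Rightarrow> 'a \<Rightarrow> real"
  assumes "finite I" and indep: "indep_vars (\<lambda>_. borel) X I"
    and mean: "\<And>i. i \<in> I \<Longrightarrow> expectation (X i) = 0"
    and bound: "\<And>i. i \<in> I \<Longrightarrow> AE \<omega> in M. \<bar>X i \<omega>\<bar> \<le> B"
  defines "V \<equiv> \<Sum>i\<in>I. variance (X i)"
  shows "norm (char (distr M borel (\<lambda>\<omega>. \<Sum>i\<in>I. X i \<omega>)) t - of_real (exp (- (t\<^sup>2 * V / 2))))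
    \<le> V * (t\<^sup>2 * (B * \<bar>t\<bar> + (B * t)\<^sup>2))"
proof -
  let ?w = "\<lambda>i. exp (- (t\<^sup>2 * variance (X i) / 2))"
  have X: "random_variable borel (X i)" if "i \<in> I" for i
    using indep that by (simp add: indep_vars_def2)
  have "exp (- (t\<^sup>2 * V / 2)) = (\<Prod>i\<in>I. ?w i)"
    unfolding V_def exp_sum[OF \<open>finite I\<close>, symmetric]
    by (simp add: sum_distrib_left sum_divide_distrib sum_negf)
  then have "norm (char (distr M borel (\<lambda>\<omega>. \<Sum>i\<in>I. X i \<omega>)) t - of_real (exp (- (t\<^sup>2 * V / 2))))
      = norm ((\<Prod>i\<in>I. char (distr M borel (X i)) t) - (\<Prod>i\<in>I. of_real (?w i)))"
    by (simp only: char_distr_sum[OF indep] of_real_prod)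
  also have "\<dots> \<le> (\<Sum>i\<in>I. norm (char (distr M borel (X i)) t - of_real (?w i)))"
    by (intro norm_prod_diff real_distribution.cmod_char_le_1 real_distribution_distr X) auto
  also have "\<dots> \<le> (\<Sum>i\<in>I. variance (X i) * (t\<^sup>2 * (B * \<bar>t\<bar> + (B * t)\<^sup>2)))"
    by (intro sum_mono char_bounded_approx_gaussian X mean bound)
  also have "\<dots> = V * (t\<^sup>2 * (B * \<bar>t\<bar> + (B * t)\<^sup>2))"
    unfolding V_def by (rule sum_distrib_right[symmetric])
  finally show ?thesis .
qed

lemma char_distr_divide:
  assumes [measurable]: "X \<in> borel_measurable M"
  shows "char (distr M borel (\<lambda>\<omega>. X \<omega> / c)) t = char (distr M borel X) (t / c)"
  by (simp add: char_def integral_distr)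

theorem central_limit_theorem_bounded_zero_mean:
  fixes M :: "nat \<Rightarrow> 'a measure" and X :: "nat \<Rightarrow> 'i \<Rightarrow> 'a \<Rightarrow> real"
  assumes M: "\<And>n. prob_space (M n)" and fin: "\<And>n. finite (I n)"
    and indep: "\<And>n. prob_space.indep_vars (M n) (\<lambda>_. borel) (X n) (I n)"
    and mean: "\<And>n i. i \<in> I n \<Longrightarrow> prob_space.expectation (M n) (X n i) = 0"
    and bound: "\<And>n i. i \<in> I n \<Longrightarrow> AE \<omega> in M n. \<bar>X n i \<omega>\<bar> \<le> B n"
  defines "V n \<equiv> \<Sum>i\<in>I n. prob_space.variance (M n) (X n i)"
  assumes V_pos: "\<forall>\<^sub>F n in sequentially. 0 < V n"
    and B: "(\<lambda>n. B n / sqrt (V n)) \<longlonglongrightarrow> 0"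
  shows "weak_conv_m (\<lambda>n. distr (M n) borel (\<lambda>\<omega>. (\<Sum>i\<in>I n. X n i \<omega>) / sqrt (V n)))
    std_normal_distribution"
    (is "weak_conv_m ?S _")
proof (rule levy_continuity)
  interpret prob_space "M n" for n by (rule M)
  have X [measurable]: "(\<lambda>\<omega>. \<Sum>i\<in>I n. X n i \<omega>) \<in> borel_measurable (M n)" for n
    using indep[of n] by (intro borel_measurable_sum) (simp add: indep_vars_def2)
  show "real_distribution (?S n)" for n by simp
  fix t :: real
  let ?r = "\<lambda>n. B n / sqrt (V n)"
  have approx: "\<forall>\<^sub>F n in sequentially.
      norm (char (?S n) t - of_real (exp (- (t\<^sup>2) / 2))) \<le> t\<^sup>2 * (?r n * \<bar>t\<bar> + (?r n * t)\<^sup>2)"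
    using V_pos
  proof eventually_elim
    case (elim n)
    define u where "u = t / sqrt (V n)"
    have V_u2: "V n * u\<^sup>2 = t\<^sup>2"
      using elim by (simp add: u_def power_divide)
    have char_eq: "char (?S n) t = char (distr (M n) borel (\<lambda>\<omega>. \<Sum>i\<in>I n. X n i \<omega>)) u"
      unfolding u_def by (rule char_distr_divide[OF X])
    have exp_eq: "exp (- (t\<^sup>2) / 2) = exp (- (u\<^sup>2 * V n / 2))"
      using V_u2 by (simp add: mult.commute)
    have "norm (char (?S n) t - of_real (exp (- (t\<^sup>2) / 2)))
        \<le> V n * (u\<^sup>2 * (B n * \<bar>u\<bar> + (B n * u)\<^sup>2))"
      unfolding char_eq exp_eq unfolding V_def
      by (intro char_sum_bounded_approx_gaussian fin indep mean bound)
    also have "\<dots> = t\<^sup>2 * (B n * \<bar>u\<bar> + (B n * u)\<^sup>2)"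
      by (simp only: V_u2 mult.assoc[symmetric])
    also have "\<dots> = t\<^sup>2 * (?r n * \<bar>t\<bar> + (?r n * t)\<^sup>2)"
      using elim by (simp add: u_def)
    finally show ?case .
  qed
  have "(\<lambda>n. t\<^sup>2 * (?r n * \<bar>t\<bar> + (?r n * t)\<^sup>2)) \<longlonglongrightarrow> t\<^sup>2 * (0 * \<bar>t\<bar> + (0 * t)\<^sup>2)"
    by (intro tendsto_mult tendsto_add tendsto_power tendsto_const B)
  then have "(\<lambda>n. t\<^sup>2 * (?r n * \<bar>t\<bar> + (?r n * t)\<^sup>2)) \<longlonglongrightarrow> 0" by simp
  then have "(\<lambda>n. char (?S n) t - of_real (exp (- (t\<^sup>2) / 2))) \<longlonglongrightarrow> 0"
    by (rule Lim_null_comparison[OF approx])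
  then show "(\<lambda>n. char (?S n) t) \<longlonglongrightarrow> char std_normal_distribution t"
    by (simp add: char_std_normal_distribution LIM_zero_iff)
qed (rule real_dist_normal_dist)

section \<open>The Poisson binomial distribution\<close>

definition poisson_binomial_pmf :: "('i \<Rightarrow> real) \<Rightarrow> 'i set \<Rightarrow> nat pmf" where
  "poisson_binomial_pmf p I =
    map_pmf (\<lambda>\<omega>. card {i\<in>I. \<omega> i}) (Pi_pmf I False (\<lambda>i. bernoulli_pmf (p i)))"

lemma poisson_binomial_pmf_insert:
  assumes "finite I" "i \<notin> I"
  shows "poisson_binomial_pmf p (insert i I) =
    bind_pmf (bernoulli_pmf (p i))
      (\<lambda>b. map_pmf (if b then Suc else id) (poisson_binomial_pmf p I))"
proof -
  have "card {j \<in> insert i I. (f(i := b)) j} = (if b then Suc else id) (card {j \<in> I. f j})"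
    for f b
  proof -
    have "{j \<in> insert i I. (f(i := b)) j} = (if b then {i} else {}) \<union> {j \<in> I. f j}"
      using assms by auto
    then show ?thesis using assms by simp
  qed
  then show ?thesis
    unfolding poisson_binomial_pmf_def Pi_pmf_insert'[OF assms]
    by (simp add: map_bind_pmf pmf.map_comp comp_def map_pmf_def bind_assoc_pmf bind_return_pmf)
qed

lemma pmf_poisson_binomial_pmf:
  assumes "finite I" and "\<And>i. i \<in> I \<Longrightarrow> p i \<in> {0..1}"
  shows "pmf (poisson_binomial_pmf p I) k = coeff (\<Prod>i\<in>I. [:1 - p i, p i:]) k"
  using assms
proof (induction I arbitrary: k)
  case empty
  then show ?case by (simp add: poisson_binomial_pmf_def indicator_def)
next
  case (insert i I)
  let ?B = "poisson_binomial_pmf p I"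
  have "pmf (map_pmf Suc ?B) k = (case k of 0 \<Rightarrow> 0 | Suc j \<Rightarrow> pmf ?B j)"
    by (cases k) (auto simp: pmf_map_inj' pmf_eq_0_set_pmf)
  then show ?case
    using insert by (simp add: poisson_binomial_pmf_insert pmf_bind coeff_pCons split: nat.split)
qed

lemma set_poisson_binomial_pmf_subset:
  "finite I \<Longrightarrow> set_pmf (poisson_binomial_pmf p I) \<subseteq> {..card I}"
  by (auto simp: poisson_binomial_pmf_def intro: card_mono)

lemma cdf_distr_standardized_pmf:
  fixes q :: "nat pmf"
  assumes "set_pmf q \<subseteq> {..n}" and "0 < b"
  shows "cdf (distr q borel (\<lambda>k. (real k - a) / b)) x
    = (\<Sum>k | k \<le> n \<and> real k \<le> a + x * b. pmf q k)"
proof -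
  let ?S = "{k. real k \<le> a + x * b}"
  have "cdf (distr q borel (\<lambda>k. (real k - a) / b)) x = measure q ?S"
    using \<open>0 < b\<close>
    by (simp add: cdf_def measure_distr vimage_def divide_le_eq diff_le_eq add.commute)
  also have "\<dots> = measure q (?S \<inter> set_pmf q)"
    by (simp add: measure_Int_set_pmf)
  also have "?S \<inter> set_pmf q = {k. k \<le> n \<and> real k \<le> a + x * b} \<inter> set_pmf q"
    using assms(1) by auto
  also have "measure q \<dots> = (\<Sum>k | k \<le> n \<and> real k \<le> a + x * b. pmf q k)"
    by (simp add: measure_Int_set_pmf measure_measure_pmf_finite)
  finally show ?thesis .
qed

lemma expectation_Pi_bernoulli_pmf:
  fixes f :: "bool \<Rightarrow> real"
  assumes "finite I" "i \<in> I" "p i \<in> {0..1}"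
  shows "measure_pmf.expectation (Pi_pmf I d (\<lambda>i. bernoulli_pmf (p i))) (\<lambda>\<omega>. f (\<omega> i))
    = f True * p i + f False * (1 - p i)"
proof -
  have "measure_pmf.expectation (Pi_pmf I d (\<lambda>i. bernoulli_pmf (p i))) (\<lambda>\<omega>. f (\<omega> i))
      = measure_pmf.expectation (map_pmf (\<lambda>\<omega>. \<omega> i) (Pi_pmf I d (\<lambda>i. bernoulli_pmf (p i)))) f"
    by simp
  also have "\<dots> = measure_pmf.expectation (bernoulli_pmf (p i)) f"
    using assms by (simp only: Pi_pmf_component if_True)
  finally show ?thesis using assms by simp
qed

theorem poisson_binomial_central_limit:
  fixes p :: "nat \<Rightarrow> 'i \<Rightarrow> real"
  assumes fin: "\<And>n. finite (I n)" and p: "\<And>n i. i \<in> I n \<Longrightarrow> p n i \<in> {0..1}"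
  defines "\<mu> n \<equiv> \<Sum>i\<in>I n. p n i" and "V n \<equiv> \<Sum>i\<in>I n. p n i * (1 - p n i)"
  assumes V: "filterlim V at_top sequentially"
  shows "weak_conv_m
    (\<lambda>n. distr (poisson_binomial_pmf (p n) (I n)) borel (\<lambda>k. (real k - \<mu> n) / sqrt (V n)))
    std_normal_distribution"
proof -
  define \<Omega> where "\<Omega> n = Pi_pmf (I n) False (\<lambda>i. bernoulli_pmf (p n i))" for n
  define X where "X n i \<omega> = of_bool (\<omega> i) - p n i" for n i and \<omega> :: "'i \<Rightarrow> bool"
  have mean: "measure_pmf.expectation (\<Omega> n) (X n i) = 0" if "i \<in> I n" for n i
    unfolding X_def \<Omega>_def using fin p that
    by (subst expectation_Pi_bernoulli_pmf[where f = "\<lambda>b. of_bool b - p n i"])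
       (auto simp: algebra_simps)
  have variance: "measure_pmf.variance (\<Omega> n) (X n i) = p n i * (1 - p n i)" if "i \<in> I n" for n i
    unfolding mean[OF that] unfolding X_def \<Omega>_def using fin p that
    by (subst expectation_Pi_bernoulli_pmf[where f = "\<lambda>b. (of_bool b - p n i - 0)\<^sup>2"])
       (auto simp: algebra_simps power2_eq_square)
  then have V_eq: "(\<Sum>i\<in>I n. measure_pmf.variance (\<Omega> n) (X n i)) = V n" for n
    unfolding V_def by (intro sum.cong) auto
  have indep: "prob_space.indep_vars (\<Omega> n) (\<lambda>_. borel) (X n) (I n)" for n
    unfolding X_def \<Omega>_def
    by (intro prob_space.indep_vars_compose2[OF prob_space_measure_pmf indep_vars_Pi_pmf] fin)
       simp
  have bound: "AE \<omega> in \<Omega> n. \<bar>X n i \<omega>\<bar> \<le> 1" if "i \<in> I n" for n i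
    using p[OF that] by (auto simp: X_def abs_le_iff)
  have "\<forall>\<^sub>F n in sequentially. 0 < V n"
    using V by (simp add: filterlim_at_top_dense)
  moreover have "(\<lambda>n. 1 / sqrt (V n)) \<longlonglongrightarrow> 0"
    by (intro tendsto_divide_0[OF tendsto_const] filterlim_at_top_imp_at_infinity
        filterlim_compose[OF sqrt_at_top V])
  ultimately have "weak_conv_m (\<lambda>n. distr (\<Omega> n) borel (\<lambda>\<omega>. (\<Sum>i\<in>I n. X n i \<omega>) / sqrt (V n)))
      std_normal_distribution"
    using central_limit_theorem_bounded_zero_mean[OF prob_space_measure_pmf fin indep mean bound]
    unfolding V_eq by simp
  moreover have "distr (poisson_binomial_pmf (p n) (I n)) borel (\<lambda>k. (real k - \<mu> n) / sqrt (V n))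
      = distr (\<Omega> n) borel (\<lambda>\<omega>. (\<Sum>i\<in>I n. X n i \<omega>) / sqrt (V n))" for n
    using fin by (simp add: poisson_binomial_pmf_def \<Omega>_def map_pmf_rep_eq distr_distr comp_def
        X_def \<mu>_def sum_subtractf Int_def)
  ultimately show ?thesis by simp
qed

corollary poisson_binomial_uniform_central_limit:
  fixes p :: "nat \<Rightarrow> 'i \<Rightarrow> real"
  assumes "\<And>n. finite (I n)" and "\<And>n i. i \<in> I n \<Longrightarrow> p n i \<in> {0..1}"
  defines "\<mu> n \<equiv> \<Sum>i\<in>I n. p n i" and "V n \<equiv> \<Sum>i\<in>I n. p n i * (1 - p n i)"
  assumes V: "filterlim V at_top sequentially"
  shows "uniform_limit UNIV
    (\<lambda>n. cdf (distr (poisson_binomial_pmf (p n) (I n)) borel (\<lambda>k. (real k - \<mu> n) / sqrt (V n))))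
    (cdf std_normal_distribution) sequentially"
proof (rule weak_conv_m_imp_uniform_limit_cdf)
  show "weak_conv_m
      (\<lambda>n. distr (poisson_binomial_pmf (p n) (I n)) borel (\<lambda>k. (real k - \<mu> n) / sqrt (V n)))
      std_normal_distribution"
    unfolding \<mu>_def V_def
    by (rule poisson_binomial_central_limit[OF assms(1,2) V[unfolded V_def]])
  show "continuous_on UNIV (cdf std_normal_distribution)"
    by (intro continuous_on_cdf_density real_distribution.finite_borel_measure_M
        real_dist_normal_dist) simp
qed (auto intro!: real_dist_normal_dist prob_space.real_distribution_distr prob_space_measure_pmf)

section \<open>The polynomials as generating functions\<close>

text \<open>As \<open>0 powr s = 0\<close> even for \<open>s = 0\<close>, the recursion also covers \<open>n = 0\<close>.\<close>

lemma Ph_Suc: "Ph s (Suc n) = smult (1 / real (Suc n) powr s) ([:real n powr s, 1:] * Ph s n)"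
proof (cases n)
  case (Suc m)
  have "[:0, 1:] * (\<Sum>k\<in>{0..m}. Ph s k) = smult (real n powr s) (Ph s n)"
    by (simp add: Suc)
  then have "[:0, 1:] * (\<Sum>k\<in>{0..n}. Ph s k) = [:real n powr s, 1:] * Ph s n"
    by (simp add: Suc sum.atLeast0_atMost_Suc distrib_left del: Ph.simps)
  then show ?thesis by simp
qed simp

definition success_prob :: "real \<Rightarrow> nat \<Rightarrow> real" where
  "success_prob s k = 1 / (1 + real k powr s)"

lemma success_prob_bounds: "success_prob s k \<in> {0..1}"
  by (simp add: success_prob_def divide_le_eq add_pos_nonneg)

lemma Ph_eq_smult_prod:
  "Ph s n = smult (poly (Ph s n) 1) (\<Prod>k<n. [:1 - success_prob s k, success_prob s k:])"
proof (induction n)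
  case (Suc n)
  have "1 + real n powr s \<noteq> 0"
    by (smt (verit) powr_ge_zero)
  then have linear: "[:real n powr s, 1:]
      = smult (1 + real n powr s) [:1 - success_prob s n, success_prob s n:]"
    by (simp add: success_prob_def field_simps)
  have "Ph s (Suc n) = smult (1 / real (Suc n) powr s)
      (smult (1 + real n powr s) [:1 - success_prob s n, success_prob s n:]
        * smult (poly (Ph s n) 1) (\<Prod>k<n. [:1 - success_prob s k, success_prob s k:]))"
    by (simp only: Ph_Suc linear Suc[symmetric])
  also have "\<dots> = smult (1 / real (Suc n) powr s * ((1 + real n powr s) * poly (Ph s n) 1))
      (\<Prod>k<Suc n. [:1 - success_prob s k, success_prob s k:])"
    by (simp only: mult_smult_left mult_smult_right smult_smult prod.lessThan_Suc mult_ac)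
  also have "1 / real (Suc n) powr s * ((1 + real n powr s) * poly (Ph s n) 1)
      = poly (Ph s (Suc n)) 1"
    by (simp add: Ph_Suc distrib_left distrib_right add.commute del: Ph.simps)
  finally show ?case .
qed simp

lemma poly_Ph_1_pos: "0 < poly (Ph s n) 1"
  by (induction n) (simp_all add: Ph_Suc add_nonneg_pos del: Ph.simps(2))

lemma Acoef_eq_pmf:
  "Acoef n k s = poly (Ph s n) 1 * pmf (poisson_binomial_pmf (success_prob s) {..<n}) k"
  unfolding Acoef_def pmf_poisson_binomial_pmf[OF finite_lessThan success_prob_bounds]
  by (subst Ph_eq_smult_prod) simp

lemma normalized_sum_Acoef_eq_cdf:
  assumes "0 < b"
  shows "1 / poly (Ph s n) 1 * (\<Sum>k | k \<le> n \<and> real k \<le> a + x * b. Acoef n k s)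
    = cdf (distr (poisson_binomial_pmf (success_prob s) {..<n}) borel (\<lambda>k. (real k - a) / b)) x"
proof -
  have "set_pmf (poisson_binomial_pmf (success_prob s) {..<n}) \<subseteq> {..n}"
    using set_poisson_binomial_pmf_subset[of "{..<n}"] by simp
  then show ?thesis
    using poly_Ph_1_pos[of s n]
    by (simp add: cdf_distr_standardized_pmf[OF _ assms] Acoef_eq_pmf sum_distrib_left[symmetric])
qed

lemma success_prob_variance_ge:
  assumes "0 \<le> s" "s \<le> 1" "k \<ge> 1"
  shows "inverse (real k) / 4 \<le> success_prob s k * (1 - success_prob s k)"
proof -
  define x where "x = real k powr s"
  have x: "1 \<le> x" using assms by (simp add: x_def ge_one_powr_ge_zero)
  have "x \<le> real k powr 1" unfolding x_def using assms by (intro powr_mono) auto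
  then have "inverse (real k) / 4 \<le> inverse x / 4" using assms x by (simp add: le_imp_inverse_le)
  also have "\<dots> = x / (2 * x)\<^sup>2" using x by (simp add: power2_eq_square field_simps)
  also have "\<dots> \<le> x / (1 + x)\<^sup>2" using x by (intro divide_left_mono power_mono mult_pos_pos) auto
  also have "\<dots> = success_prob s k * (1 - success_prob s k)"
    using x by (simp add: success_prob_def x_def[symmetric] power2_eq_square field_simps)
  finally show ?thesis .
qed

lemma sum_success_prob_variance_at_top:
  assumes s: "0 \<le> s" "s \<le> 1"
  shows "filterlim (\<lambda>n. \<Sum>k<n. success_prob s k * (1 - success_prob s k)) at_top sequentially"
    (is "filterlim (\<lambda>n. \<Sum>k<n. ?v k) _ _")
proof -
  have "filterlim (\<lambda>n. harm n / 4 :: real) at_top sequentially"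
    using filterlim_tendsto_pos_mult_at_top[OF tendsto_const[of "1 / 4 :: real"] _ harm_at_top]
    by simp
  moreover have "harm n / 4 \<le> (\<Sum>k<Suc n. ?v k)" for n
  proof -
    have "harm n / 4 \<le> (\<Sum>k=1..n. ?v k)"
      unfolding harm_def sum_divide_distrib by (intro sum_mono success_prob_variance_ge s) auto
    also have "\<dots> \<le> (\<Sum>k<Suc n. ?v k)"
      using success_prob_bounds by (intro sum_mono2 mult_nonneg_nonneg) auto
    finally show ?thesis .
  qed
  ultimately have "filterlim (\<lambda>n. \<Sum>k<Suc n. ?v k) at_top sequentially"
    by (rule filterlim_at_top_mono[OF _ always_eventually[OF allI]])
  then show ?thesis by (rule filterlim_sequentially_Suc[THEN iffD1])
qed

theorem theorem1:
  fixes s :: real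
  assumes "s \<in> {0..1}"
  shows "\<exists>a b :: nat \<Rightarrow> real.
    (\<forall>\<^sub>F n in sequentially. b n > 0) \<and>
    (\<lambda>n. SUP x::real.
        \<bar>1 / poly (Ph s n) 1 * (\<Sum>k | k \<le> n \<and> real k \<le> a n + x * b n. Acoef n k s)
          - 1 / sqrt (2 * pi) * (LBINT t:{..x}. exp (- t\<^sup>2 / 2))\<bar>) \<longlonglongrightarrow> 0"
proof -
  define V where "V n = (\<Sum>k<n. success_prob s k * (1 - success_prob s k))" for n
  define a where "a n = (\<Sum>k<n. success_prob s k)" for n
  define b where "b n = sqrt (V n)" for n
  have V: "filterlim V at_top sequentially"
    unfolding V_def using assms by (intro sum_success_prob_variance_at_top) auto
  then have b: "\<forall>\<^sub>F n in sequentially. 0 < b n"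
    by (simp add: b_def filterlim_at_top_dense)
  have "uniform_limit UNIV (\<lambda>n. cdf (distr (poisson_binomial_pmf (success_prob s) {..<n}) borel
      (\<lambda>k. (real k - a n) / b n))) (cdf std_normal_distribution) sequentially"
    unfolding a_def b_def V_def
    by (rule poisson_binomial_uniform_central_limit[OF finite_lessThan success_prob_bounds
        V[unfolded V_def]])
  note lim = uniform_limit_imp_SUP_dist_tendsto_0[OF this UNIV_not_empty]
  show ?thesis
    by (intro exI[of _ a] exI[of _ b] conjI b Lim_transform_eventually[OF lim],
        use b in eventually_elim)
       (simp only: dist_real_def normalized_sum_Acoef_eq_cdf cdf_std_normal_distribution)
qed

end
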